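(* Let $A$ be a skew left brace. Then $\{(\lambda_a,a):a\in A\}$ is a regular subgroup of $\mathrm{Hol}(A,\cdot)$. Conversely, if $(A,\cdot)$ is a group and $H$ is a regular subgroup of $\mathrm{Hol}(A,\cdot)$, then $A$ is a skew left brace with $(A,\circ)\simeq H$, where $$a\circ b=af(b)\qquad(a,b\in A)$$ and $f\in\mathrm{Aut}(A,\cdot)$ is determined by $a$ through $(\pi_2|_H)^{-1}(a)=(f,a)\in H$.
   Context: A skew left brace is a set $A$ with two group structures, $(A,\cdot)$ (written $(a,b)\mapsto ab$, with inverse $a^{-1}$, not necessarily abelian) and $(A,\circ)$, such that $a\circ(bc)=(a\circ b)a^{-1}(a\circ c)$ for all $a,b,c\in A$. For $a\in A$, $\lambda_a\colon A\to A$ is the map $\lambda_a(b)=a^{-1}(a\circ b)$; it is an automorphism of $(A,\cdot)$. For a group $A$, the holomorph $\mathrm{Hol}(A)=\mathrm{Aut}(A)\ltimes A$ is the set of pairs $(f,a)$, $f\in\mathrm{Aut}(A)$, $a\in A$, with product $(f,a)(g,b)=(fg,af(b))$. It acts on $A$ by $(f,x)\cdot a=xf(a)$. The map $\pi_2\colon\mathrm{Hol}(A)\to A$ is $\pi_2(f,a)=a$. A subgroup $H$ of $\mathrm{Hol}(A)$ is regular if for each $a\in A$ there exists a unique $(f,x)\in H$ such that $xf(a)=1$. It is well known that for a regular subgroup $H$ the restriction $\pi_2|_H\colon H\to A$ is bijective. *)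

theory Defs
  imports "HOL-Algebra.Bij"
begin

text \<open>
  The two group structures of a skew left brace are two records over the same carrier:
  \<open>A\<close> is the group written multiplicatively in the literature and \<open>C\<close> is the circle group.
\<close>

locale skew_left_brace = mul: group A + circ: group C
  for A :: "('a, 'm) monoid_scheme" (structure) and C :: "('a, 'n) monoid_scheme" +
  assumes carrier_eq: "carrier C = carrier A"
    and circ_mult:
      "\<lbrakk>a \<in> carrier A; b \<in> carrier A; c \<in> carrier A\<rbrakk> \<Longrightarrow>
        a \<otimes>\<^bsub>C\<^esub> (b \<otimes> c) = (a \<otimes>\<^bsub>C\<^esub> b) \<otimes> inv a \<otimes> (a \<otimes>\<^bsub>C\<^esub> c)"

text \<open>
  Automorphisms in \<^const>\<open>auto\<close> are extensional (\<^const>\<open>undefined\<close> off the carrier), hence the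
  restriction to the carrier in the next definition.
\<close>

definition lambda_map ::
  "('a, 'm) monoid_scheme \<Rightarrow> ('a, 'n) monoid_scheme \<Rightarrow> 'a \<Rightarrow> 'a \<Rightarrow> 'a" where
  "lambda_map A C a = (\<lambda>b\<in>carrier A. inv\<^bsub>A\<^esub> a \<otimes>\<^bsub>A\<^esub> (a \<otimes>\<^bsub>C\<^esub> b))"

definition Hol :: "('a, 'm) monoid_scheme \<Rightarrow> (('a \<Rightarrow> 'a) \<times> 'a) monoid" where
  "Hol A =
    \<lparr>carrier = carrier (AutoGroup A) \<times> carrier A,
     mult = \<lambda>(f, a) (g, b). (f \<otimes>\<^bsub>AutoGroup A\<^esub> g, a \<otimes>\<^bsub>A\<^esub> f b),
     one = (\<one>\<^bsub>AutoGroup A\<^esub>, \<one>\<^bsub>A\<^esub>)\<rparr>"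

definition hol_act :: "('a, 'm) monoid_scheme \<Rightarrow> ('a \<Rightarrow> 'a) \<times> 'a \<Rightarrow> 'a \<Rightarrow> 'a" where
  "hol_act A = (\<lambda>(f, x) a. x \<otimes>\<^bsub>A\<^esub> f a)"

definition regular_subgroup ::
  "('a, 'm) monoid_scheme \<Rightarrow> (('a \<Rightarrow> 'a) \<times> 'a) set \<Rightarrow> bool" where
  "regular_subgroup A H \<longleftrightarrow>
    subgroup H (Hol A) \<and> (\<forall>a\<in>carrier A. \<exists>!p. p \<in> H \<and> hol_act A p a = \<one>\<^bsub>A\<^esub>)"

text \<open>
  The projection \<open>\<pi>\<^sub>2\<close> is \<^const>\<open>snd\<close>, and \<open>inv_into H snd\<close> is the inverse of its restriction
  to \<open>H\<close>; it is a genuine inverse for regular \<open>H\<close> by \<open>regular_subgroup_bij_betw_snd\<close> below.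
  The identity of the circle group is necessarily that of \<open>A\<close>.
\<close>

definition circle_group ::
  "('a, 'm) monoid_scheme \<Rightarrow> (('a \<Rightarrow> 'a) \<times> 'a) set \<Rightarrow> 'a monoid" where
  "circle_group A H =
    \<lparr>carrier = carrier A,
     mult = \<lambda>a b. a \<otimes>\<^bsub>A\<^esub> (fst (inv_into H snd a)) b,
     one = \<one>\<^bsub>A\<^esub>\<rparr>"

lemma carrier_AutoGroup: "carrier (AutoGroup A) = auto A"
  by (simp add: AutoGroup_def)

lemma mult_AutoGroup:
  "\<lbrakk>f \<in> auto A; g \<in> auto A\<rbrakk> \<Longrightarrow> f \<otimes>\<^bsub>AutoGroup A\<^esub> g = compose (carrier A) f g"
  by (simp add: AutoGroup_def BijGroup_def auto_def)

lemma one_AutoGroup: "\<one>\<^bsub>AutoGroup A\<^esub> = (\<lambda>x\<in>carrier A. x)"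
  by (simp add: AutoGroup_def BijGroup_def)

lemma auto_closed: "\<lbrakk>f \<in> auto A; x \<in> carrier A\<rbrakk> \<Longrightarrow> f x \<in> carrier A"
  by (auto simp: auto_def hom_def)

lemma auto_mult:
  "\<lbrakk>f \<in> auto A; x \<in> carrier A; y \<in> carrier A\<rbrakk> \<Longrightarrow> f (x \<otimes>\<^bsub>A\<^esub> y) = f x \<otimes>\<^bsub>A\<^esub> f y"
  by (auto simp: auto_def hom_def)

lemma (in group) auto_one: "f \<in> auto G \<Longrightarrow> f \<one> = \<one>"
  using hom_one[of f G] is_group by (auto simp: auto_def)

lemma (in group) group_Hol: "group (Hol G)"
proof -
  interpret Aut: group "AutoGroup G" by (rule AutoGroup)
  have cl: "f \<otimes>\<^bsub>AutoGroup G\<^esub> g \<in> auto G" if "f \<in> auto G" "g \<in> auto G" for f g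
    using Aut.m_closed that by (simp add: carrier_AutoGroup)
  show ?thesis
  proof (rule groupI)
    fix p q assume "p \<in> carrier (Hol G)" "q \<in> carrier (Hol G)"
    then show "p \<otimes>\<^bsub>Hol G\<^esub> q \<in> carrier (Hol G)"
      by (auto simp: Hol_def carrier_AutoGroup cl auto_closed)
  next
    show "\<one>\<^bsub>Hol G\<^esub> \<in> carrier (Hol G)"
      by (simp add: Hol_def)
  next
    fix p q r
    assume "p \<in> carrier (Hol G)" "q \<in> carrier (Hol G)" "r \<in> carrier (Hol G)"
    then obtain f a g b h c where eqs: "p = (f, a)" "q = (g, b)" "r = (h, c)"
      and mem: "f \<in> auto G" "g \<in> auto G" "h \<in> auto G"
        "a \<in> carrier G" "b \<in> carrier G" "c \<in> carrier G"
      by (auto simp: Hol_def carrier_AutoGroup)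
    have "f \<otimes>\<^bsub>AutoGroup G\<^esub> g \<otimes>\<^bsub>AutoGroup G\<^esub> h = f \<otimes>\<^bsub>AutoGroup G\<^esub> (g \<otimes>\<^bsub>AutoGroup G\<^esub> h)"
      using mem by (simp add: Aut.m_assoc carrier_AutoGroup)
    moreover have "(f \<otimes>\<^bsub>AutoGroup G\<^esub> g) c = f (g c)"
      using mem by (simp add: mult_AutoGroup compose_def)
    ultimately show "p \<otimes>\<^bsub>Hol G\<^esub> q \<otimes>\<^bsub>Hol G\<^esub> r = p \<otimes>\<^bsub>Hol G\<^esub> (q \<otimes>\<^bsub>Hol G\<^esub> r)"
      using mem by (simp add: eqs Hol_def m_assoc auto_closed auto_mult)
  next
    fix p assume "p \<in> carrier (Hol G)"
    then show "\<one>\<^bsub>Hol G\<^esub> \<otimes>\<^bsub>Hol G\<^esub> p = p"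
      by (auto simp: Hol_def) (simp add: one_AutoGroup)
  next
    fix p assume "p \<in> carrier (Hol G)"
    then obtain f a where p: "p = (f, a)" and f: "f \<in> auto G" and a: "a \<in> carrier G"
      by (auto simp: Hol_def carrier_AutoGroup)
    let ?g = "inv\<^bsub>AutoGroup G\<^esub> f"
    have g: "?g \<in> auto G"
      using Aut.inv_closed f by (simp add: carrier_AutoGroup)
    have inv_eq: "?g (inv a) \<otimes> ?g a = \<one>"
      using auto_mult[OF g, of "inv a" a] auto_one[OF g] a by simp
    have "(?g, ?g (inv a)) \<in> carrier (Hol G)"
      using g a by (simp add: Hol_def carrier_AutoGroup auto_closed)
    moreover have "(?g, ?g (inv a)) \<otimes>\<^bsub>Hol G\<^esub> p = \<one>\<^bsub>Hol G\<^esub>"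
      using f inv_eq by (simp add: p Hol_def Aut.l_inv carrier_AutoGroup)
    ultimately show "\<exists>q\<in>carrier (Hol G). q \<otimes>\<^bsub>Hol G\<^esub> p = \<one>\<^bsub>Hol G\<^esub>"
      by blast
  qed
qed

lemma (in group) hol_act_mult:
  assumes "p \<in> carrier (Hol G)" "q \<in> carrier (Hol G)" "a \<in> carrier G"
  shows "hol_act G (p \<otimes>\<^bsub>Hol G\<^esub> q) a = hol_act G p (hol_act G q a)"
  using assms
  by (auto simp: Hol_def hol_act_def carrier_AutoGroup mult_AutoGroup compose_def
      auto_mult auto_closed m_assoc)

lemma (in group) hol_act_one: "a \<in> carrier G \<Longrightarrow> hol_act G \<one>\<^bsub>Hol G\<^esub> a = a"
  by (simp add: Hol_def hol_act_def one_AutoGroup)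

lemma (in group) hol_act_at_one: "p \<in> carrier (Hol G) \<Longrightarrow> hol_act G p \<one> = snd p"
  by (auto simp: Hol_def hol_act_def carrier_AutoGroup auto_one)

lemma (in group) regular_subgroup_bij_betw_snd:
  assumes "regular_subgroup G H"
  shows "bij_betw snd H (carrier G)"
proof -
  interpret Hol: group "Hol G" by (rule group_Hol)
  have H: "subgroup H (Hol G)"
    and reg: "\<And>a. a \<in> carrier G \<Longrightarrow> \<exists>!p. p \<in> H \<and> hol_act G p a = \<one>"
    using assms by (auto simp: regular_subgroup_def)
  have sub: "p \<in> carrier (Hol G)" if "p \<in> H" for p
    using subgroup.subset[OF H] that by blast
  have snd_cl: "snd p \<in> carrier G" if "p \<in> H" for p
    using sub[OF that] by (auto simp: Hol_def)
  have inv_act: "hol_act G (inv\<^bsub>Hol G\<^esub> p) (snd p) = \<one>" if "p \<in> H" for p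
    using hol_act_mult[of "inv\<^bsub>Hol G\<^esub> p" p \<one>] sub[OF that]
    by (simp add: hol_act_at_one[symmetric] hol_act_one)
  have "p = q" if "p \<in> H" "q \<in> H" "snd p = snd q" for p q
  proof -
    have "inv\<^bsub>Hol G\<^esub> p = inv\<^bsub>Hol G\<^esub> q"
      using reg[OF snd_cl[OF that(1)]] inv_act[OF that(1)] inv_act[OF that(2)] that
        subgroup.m_inv_closed[OF H] by metis
    then show ?thesis
      using sub that by (metis Hol.inv_inv)
  qed
  moreover have "a \<in> snd ` H" if a: "a \<in> carrier G" for a
  proof -
    obtain p where p: "p \<in> H" "hol_act G p a = \<one>"
      using reg[OF a] by blast
    have "snd (inv\<^bsub>Hol G\<^esub> p) = hol_act G (inv\<^bsub>Hol G\<^esub> p) (hol_act G p a)"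
      using p sub by (simp add: hol_act_at_one)
    also have "\<dots> = a"
      using hol_act_mult[of "inv\<^bsub>Hol G\<^esub> p" p a] sub[OF p(1)] a by (simp add: hol_act_one)
    finally show ?thesis
      using subgroup.m_inv_closed[OF H p(1)] by force
  qed
  ultimately show ?thesis
    using snd_cl by (auto simp: bij_betw_def inj_on_def)
qed

end

theory Submission
  imports Defs
begin

text \<open>
  Both directions say that a group homomorphism is hidden in the formula
  \<open>a \<circ> b = a \<cdot> f(b)\<close>, because the product of \<open>Hol A\<close> has second component
  \<open>\<pi>\<^sub>2 ((f, a) (g, b)) = a \<cdot> f(b)\<close>.

  For a brace, \<open>a \<circ> b = a \<cdot> \<lambda>\<^sub>a(b)\<close>, the brace identity says that \<open>\<lambda>\<^sub>a\<close> respects the product of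
  \<open>A\<close>, and associativity of \<open>\<circ>\<close> turns into \<open>\<lambda>\<^bsub>a\<circ>b\<^esub> = \<lambda>\<^sub>a \<lambda>\<^sub>b\<close>.  Hence \<open>a \<mapsto> (\<lambda>\<^sub>a, a)\<close> is a
  homomorphism from the circle group to the holomorph and its image is a subgroup
  (\<open>lambda_pair_hom\<close>).  Since \<open>(\<lambda>\<^sub>x, x)\<close> sends \<open>a\<close> to \<open>x \<circ> a\<close>, regularity is the
  existence and uniqueness of inverses in the circle group.

  For a regular subgroup \<open>H\<close>, the projection \<open>\<pi>\<^sub>2\<close> is a bijection from \<open>H\<close> to \<open>A\<close>, and
  \<open>\<circ>\<close> is by definition the product of \<open>H\<close> transported along it.  So the circle structure is a
  group isomorphic to \<open>H\<close> (\<open>snd_iso_circle_group\<close>), and the brace identity expresses that the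
  first components of the elements of \<open>H\<close> are automorphisms of \<open>A\<close>.
\<close>

context skew_left_brace
begin

lemma circ_closed:
  "\<lbrakk>a \<in> carrier A; b \<in> carrier A\<rbrakk> \<Longrightarrow> a \<otimes>\<^bsub>C\<^esub> b \<in> carrier A"
  using circ.m_closed by (simp add: carrier_eq)

lemma lambda_map_apply:
  "b \<in> carrier A \<Longrightarrow> lambda_map A C a b = inv a \<otimes> (a \<otimes>\<^bsub>C\<^esub> b)"
  by (simp add: lambda_map_def)

lemma lambda_map_closed:
  "\<lbrakk>a \<in> carrier A; b \<in> carrier A\<rbrakk> \<Longrightarrow> lambda_map A C a b \<in> carrier A"
  by (simp add: lambda_map_apply circ_closed)

lemma mult_lambda_map:
  "\<lbrakk>a \<in> carrier A; b \<in> carrier A\<rbrakk> \<Longrightarrow> a \<otimes> lambda_map A C a b = a \<otimes>\<^bsub>C\<^esub> b"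
  by (simp add: lambda_map_apply circ_closed mul.m_assoc[symmetric])

lemma lambda_map_mult:
  assumes "a \<in> carrier A" "b \<in> carrier A" "c \<in> carrier A"
  shows "lambda_map A C a (b \<otimes> c) = lambda_map A C a b \<otimes> lambda_map A C a c"
  using assms by (simp add: lambda_map_apply circ_mult circ_closed mul.m_assoc)

text \<open>
  Being multiplicative, \<open>\<lambda>\<^sub>a\<close> fixes \<open>\<one>\<close>, so \<open>a \<circ> \<one> = a\<close> for all \<open>a\<close>; taking for \<open>a\<close> the identity
  of the circle group identifies it with \<open>\<one>\<close>.
\<close>

lemma one_circ: "\<one>\<^bsub>C\<^esub> = \<one>"
proof -
  have e: "\<one>\<^bsub>C\<^esub> \<in> carrier A"
    using circ.one_closed by (simp add: carrier_eq)
  have "lambda_map A C \<one>\<^bsub>C\<^esub> \<one> \<otimes> lambda_map A C \<one>\<^bsub>C\<^esub> \<one> = lambda_map A C \<one>\<^bsub>C\<^esub> \<one>"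
    using lambda_map_mult[OF e, of \<one> \<one>] by simp
  then have "lambda_map A C \<one>\<^bsub>C\<^esub> \<one> = \<one>"
    using lambda_map_closed[OF e, of \<one>] mul.l_cancel_one by blast
  then have "\<one>\<^bsub>C\<^esub> = \<one>\<^bsub>C\<^esub> \<otimes>\<^bsub>C\<^esub> \<one>"
    using mult_lambda_map[OF e, of \<one>] e by simp
  then show ?thesis
    by (simp add: carrier_eq)
qed

text \<open>
  Associativity of \<open>\<circ>\<close>: both \<open>(a \<circ> b) \<cdot> \<lambda>\<^bsub>a\<circ>b\<^esub>(c)\<close> and \<open>(a \<circ> b) \<cdot> \<lambda>\<^sub>a(\<lambda>\<^sub>b(c))\<close> equal the triple
  circle product of \<open>a\<close>, \<open>b\<close>, \<open>c\<close>, and \<open>a \<circ> b\<close> cancels.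
\<close>

lemma lambda_map_circ_apply:
  assumes "a \<in> carrier A" "b \<in> carrier A" "c \<in> carrier A"
  shows "lambda_map A C (a \<otimes>\<^bsub>C\<^esub> b) c = lambda_map A C a (lambda_map A C b c)"
proof -
  have "(a \<otimes>\<^bsub>C\<^esub> b) \<otimes> lambda_map A C (a \<otimes>\<^bsub>C\<^esub> b) c = a \<otimes>\<^bsub>C\<^esub> (b \<otimes>\<^bsub>C\<^esub> c)"
    using assms circ.m_assoc by (simp add: mult_lambda_map circ_closed carrier_eq)
  also have "\<dots> = a \<otimes> lambda_map A C a (b \<otimes> lambda_map A C b c)"
    using assms by (simp add: mult_lambda_map circ_closed)
  also have "\<dots> = (a \<otimes> lambda_map A C a b) \<otimes> lambda_map A C a (lambda_map A C b c)"
    using assms by (simp add: lambda_map_mult lambda_map_closed mul.m_assoc)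
  also have "\<dots> = (a \<otimes>\<^bsub>C\<^esub> b) \<otimes> lambda_map A C a (lambda_map A C b c)"
    using assms by (simp add: mult_lambda_map)
  finally show ?thesis
    using assms by (simp add: circ_closed lambda_map_closed)
qed

lemma lambda_map_one: "b \<in> carrier A \<Longrightarrow> lambda_map A C \<one> b = b"
  using circ.l_one[unfolded one_circ carrier_eq, of b] by (simp add: lambda_map_apply)

text \<open>
  The inverse of \<open>\<lambda>\<^sub>a\<close> is \<open>\<lambda>\<close> at the circle inverse of \<open>a\<close>, by \<open>lambda_map_circ_apply\<close>.
\<close>

lemma lambda_map_auto:
  assumes a: "a \<in> carrier A"
  shows "lambda_map A C a \<in> auto A"
proof -
  have a': "inv\<^bsub>C\<^esub> a \<in> carrier A"
    using a circ.inv_closed by (simp add: carrier_eq)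
  have "lambda_map A C (inv\<^bsub>C\<^esub> a) (lambda_map A C a b) = b"
    and "lambda_map A C a (lambda_map A C (inv\<^bsub>C\<^esub> a) b) = b" if "b \<in> carrier A" for b
    using a a' that circ.l_inv circ.r_inv
    by (simp_all add: lambda_map_circ_apply[symmetric] carrier_eq one_circ lambda_map_one)
  then have "bij_betw (lambda_map A C a) (carrier A) (carrier A)"
    using a a'
    by (intro bij_betw_byWitness[where f' = "lambda_map A C (inv\<^bsub>C\<^esub> a)"])
      (auto simp: lambda_map_closed)
  moreover have "lambda_map A C a \<in> extensional (carrier A)"
    by (simp add: lambda_map_def)
  moreover have "lambda_map A C a \<in> hom A A"
    using a by (simp add: hom_def lambda_map_closed lambda_map_mult)
  ultimately show ?thesis
    by (simp add: auto_def Bij_def)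
qed

lemma lambda_map_circ:
  assumes "a \<in> carrier A" "b \<in> carrier A"
  shows "lambda_map A C (a \<otimes>\<^bsub>C\<^esub> b) = compose (carrier A) (lambda_map A C a) (lambda_map A C b)"
proof (rule extensionalityI)
  show "lambda_map A C (a \<otimes>\<^bsub>C\<^esub> b) \<in> extensional (carrier A)"
    by (simp add: lambda_map_def)
  show "compose (carrier A) (lambda_map A C a) (lambda_map A C b) \<in> extensional (carrier A)"
    by (rule compose_extensional)
qed (simp add: assms lambda_map_circ_apply compose_eq)

lemma lambda_pair_hom: "(\<lambda>a. (lambda_map A C a, a)) \<in> hom C (Hol A)"
  by (auto simp: hom_def carrier_eq Hol_def carrier_AutoGroup lambda_map_auto mult_AutoGroup
      lambda_map_circ mult_lambda_map)

theorem lambda_pairs_regular_subgroup: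
  "regular_subgroup A {(lambda_map A C a, a) | a. a \<in> carrier A}"
proof -
  let ?H = "{(lambda_map A C a, a) | a. a \<in> carrier A}"
  have "group_hom C (Hol A) (\<lambda>a. (lambda_map A C a, a))"
    using circ.is_group mul.group_Hol lambda_pair_hom
    by (simp add: group_hom_def group_hom_axioms_def)
  moreover have "?H = (\<lambda>a. (lambda_map A C a, a)) ` carrier C"
    by (auto simp: carrier_eq)
  ultimately have "subgroup ?H (Hol A)"
    using group_hom.img_is_subgroup by metis
  moreover have "\<exists>!p. p \<in> ?H \<and> hol_act A p a = \<one>" if a: "a \<in> carrier A" for a
  proof -
    have act: "hol_act A (lambda_map A C x, x) a = x \<otimes>\<^bsub>C\<^esub> a" if "x \<in> carrier A" for x
      using a that by (simp add: hol_act_def mult_lambda_map)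
    show ?thesis
    proof (rule ex1I[of _ "(lambda_map A C (inv\<^bsub>C\<^esub> a), inv\<^bsub>C\<^esub> a)"])
      have "inv\<^bsub>C\<^esub> a \<in> carrier A"
        using a circ.inv_closed by (simp add: carrier_eq)
      then show "(lambda_map A C (inv\<^bsub>C\<^esub> a), inv\<^bsub>C\<^esub> a) \<in> ?H
          \<and> hol_act A (lambda_map A C (inv\<^bsub>C\<^esub> a), inv\<^bsub>C\<^esub> a) a = \<one>"
        using a circ.l_inv by (auto simp: act carrier_eq one_circ)
    next
      fix p assume p: "p \<in> ?H \<and> hol_act A p a = \<one>"
      then obtain x where x: "x \<in> carrier A" "p = (lambda_map A C x, x)"
        by blast
      then have "inv\<^bsub>C\<^esub> a = x"
        using a p circ.inv_equality[of x a] by (simp add: act carrier_eq one_circ)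
      then show "p = (lambda_map A C (inv\<^bsub>C\<^esub> a), inv\<^bsub>C\<^esub> a)"
        using x by simp
    qed
  qed
  ultimately show ?thesis
    by (simp add: regular_subgroup_def)
qed

end

context group
begin

lemma fst_inv_into_snd_auto:
  assumes H: "regular_subgroup G H" and a: "a \<in> carrier G"
  shows "fst (inv_into H snd a) \<in> auto G"
proof -
  have "inv_into H snd a \<in> H"
    using regular_subgroup_bij_betw_snd[OF H] a
    by (metis bij_betw_imp_surj_on inv_into_into)
  then have "inv_into H snd a \<in> carrier (Hol G)"
    using H subgroup.subset by (auto simp: regular_subgroup_def)
  then show ?thesis
    by (auto simp: Hol_def carrier_AutoGroup)
qed

lemma snd_iso_circle_group:
  assumes H: "regular_subgroup G H"
  shows "snd \<in> iso ((Hol G)\<lparr>carrier := H\<rparr>) (circle_group G H)"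
proof -
  have bij: "bij_betw snd H (carrier G)"
    by (rule regular_subgroup_bij_betw_snd[OF H])
  have "snd (p \<otimes>\<^bsub>Hol G\<^esub> q) = snd p \<otimes> fst (inv_into H snd (snd p)) (snd q)" if "p \<in> H" for p q
    using that bij by (simp add: bij_betw_def Hol_def split_beta)
  then show ?thesis
    using bij by (auto simp: iso_def hom_def circle_group_def dest: bij_betwE)
qed

lemma group_circle_group:
  assumes H: "regular_subgroup G H"
  shows "group (circle_group G H)"
proof -
  have "group ((Hol G)\<lparr>carrier := H\<rparr>)"
    using H group_Hol by (simp add: regular_subgroup_def subgroup.subgroup_is_group)
  then have "group ((circle_group G H)\<lparr>one := snd \<one>\<^bsub>(Hol G)\<lparr>carrier := H\<rparr>\<^esub>\<rparr>)"
    using group.iso_imp_img_group snd_iso_circle_group[OF H] by blast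
  \<comment> \<open>The update is void: the identity of the holomorph has second component \<open>\<one>\<close>.\<close>
  then show ?thesis
    by (simp add: circle_group_def Hol_def)
qed

text \<open>
  With \<open>f\<close> the automorphism attached to \<open>a\<close>, the brace identity is
  \<open>a \<cdot> f(b \<cdot> c) = a \<cdot> f(b) \<cdot> a\<^sup>-\<^sup>1 \<cdot> a \<cdot> f(c)\<close>.
\<close>

theorem skew_left_brace_circle_group:
  assumes H: "regular_subgroup G H"
  shows "skew_left_brace G (circle_group G H)"
proof -
  have "a \<otimes>\<^bsub>circle_group G H\<^esub> (b \<otimes> c)
      = (a \<otimes>\<^bsub>circle_group G H\<^esub> b) \<otimes> inv a \<otimes> (a \<otimes>\<^bsub>circle_group G H\<^esub> c)"
    if "a \<in> carrier G" "b \<in> carrier G" "c \<in> carrier G" for a b c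
  proof -
    let ?f = "fst (inv_into H snd a)"
    have f: "?f \<in> auto G"
      using H that by (simp add: fst_inv_into_snd_auto)
    have "inv a \<otimes> (a \<otimes> ?f c) = ?f c"
      using that auto_closed[OF f] by (simp add: m_assoc[symmetric])
    then show ?thesis
      using that auto_closed[OF f] by (simp add: circle_group_def auto_mult[OF f] m_assoc)
  qed
  then show ?thesis
    using group_circle_group[OF H] is_group
    by (simp add: skew_left_brace_def skew_left_brace_axioms_def circle_group_def)
qed

theorem circle_group_iso_regular_subgroup:
  assumes H: "regular_subgroup G H"
  shows "circle_group G H \<cong> (Hol G)\<lparr>carrier := H\<rparr>"
proof -
  have "group ((Hol G)\<lparr>carrier := H\<rparr>)"
    using H group_Hol by (simp add: regular_subgroup_def subgroup.subgroup_is_group)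
  then show ?thesis
    using snd_iso_circle_group[OF H] group.iso_sym is_isoI by blast
qed

end

theorem theorem4p2:
  fixes A :: "('a, 'm) monoid_scheme"
    and C :: "('a, 'n) monoid_scheme"
    and H :: "(('a \<Rightarrow> 'a) \<times> 'a) set"
  shows "(skew_left_brace A C \<longrightarrow>
            regular_subgroup A {(lambda_map A C a, a) | a. a \<in> carrier A})
       \<and> (group A \<and> regular_subgroup A H \<longrightarrow>
            skew_left_brace A (circle_group A H)
            \<and> circle_group A H \<cong> (Hol A)\<lparr>carrier := H\<rparr>)"
  using skew_left_brace.lambda_pairs_regular_subgroup group.skew_left_brace_circle_group
    group.circle_group_iso_regular_subgroup
  by blast

end
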